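(* Fix $t\ge1$, $\Delta\ge 0$ and a sample index $j$. Let $(\mathbf{x}_{t-1}^{(j)},w_{t-1}^{(j)})$ be a weighted sample properly weighted with respect to $\pi_{t-1}(\mathbf{x}_{t-1})$. Define $$w_t^{(1,j)}=w_{t-1}^{(j)}\,\frac{\pi_{t+\Delta}(\mathbf{x}_{t-1}^{(j)})}{\pi_{t-1}(\mathbf{x}_{t-1}^{(j)})},$$ the weight (with respect to $\pi_{t+\Delta}(\mathbf{x}_t)$) of the exact lookahead sample $(\mathbf{x}_{t-1}^{(j)},x_t^{(1,j)})$ with $x_t^{(1,j)}\sim \pi_{t+\Delta}(x_t\mid\mathbf{x}_{t-1}^{(j)})$. Let $x_t^{(2,j)}$ be generated from a trial distribution $q_t(x_t\mid\mathbf{x}_{t-1}^{(j)})$ which does not depend on $y_{t+1},\dots,y_{t+\Delta}$, put $\mathbf{x}_t^{(2,j)}=(\mathbf{x}_{t-1}^{(j)},x_t^{(2,j)})$ and $$w_t^{(2,j)}=w_{t-1}^{(j)}\,\frac{\pi_{t+\Delta}(\mathbf{x}_t^{(2,j)})}{\pi_{t-1}(\mathbf{x}_{t-1}^{(j)})\,q_t(x_t^{(2,j)}\mid\mathbf{x}_{t-1}^{(j)})}.$$ Then $$\operatorname{var}_{\pi_{t+\Delta}}\big(w_t^{(2,j)}\big)\ \ge\ \operatorname{var}_{\pi_{t+\Delta}}\big(w_t^{(1,j)}\big),$$ and, for every square integrable function $h$ of $\mathbf{x}_t$, $$\operatorname{var}_{\pi_{t+\Delta}}\big[w_t^{(2,j)}h(\mathbf{x}_t^{(2,j)})\big]\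 \ge\ \operatorname{var}_{\pi_{t+\Delta}}\Big[w_t^{(1,j)}E_{\pi_{t+\Delta}}\big(h(\mathbf{x}_t)\mid\mathbf{x}_{t-1}=\mathbf{x}_{t-1}^{(j)}\big)\Big],$$ $$\operatorname{var}_{\pi_{t+\Delta}}\Big[w_t^{(2,j)}E_{\pi_{t+\Delta}}\big(h(\mathbf{x}_t)\mid\mathbf{x}_{t-1}=\mathbf{x}_{t-1}^{(j)}\big)\Big]\ \ge\ \operatorname{var}_{\pi_{t+\Delta}}\Big[w_t^{(1,j)}E_{\pi_{t+\Delta}}\big(h(\mathbf{x}_t)\mid\mathbf{x}_{t-1}=\mathbf{x}_{t-1}^{(j)}\big)\Big].$$
   Context: Latent states $x_0,x_1,\dots$ and observations $y_1,y_2,\dots$ have a joint distribution with densities with respect to fixed $\sigma$-finite (product) measures, written $dx$. Write $\mathbf{x}_t=(x_0,\dots,x_t)$, $\mathbf{y}_t=(y_1,\dots,y_t)$ and $\pi_t(\mathbf{x}_t)=p(\mathbf{x}_t\mid\mathbf{y}_t)$. For any times $s,t$, $\pi_t(\mathbf{x}_s)=p(\mathbf{x}_s\mid\mathbf{y}_t)$ is the conditional density of $\mathbf{x}_s$ given $\mathbf{y}_t$, and $\pi_t(x_s\mid\mathbf{x}_{s-1})=p(x_s\mid\mathbf{x}_{s-1},\mathbf{y}_t)$. Properly weighted: $(\mathbf{x}_{t-1}^{(j)},w_{t-1}^{(j)})$ is properly weighted with respect to $\pi_{t-1}(\mathbf{x}_{t-1})$ if $\mathbf{x}_{t-1}^{(j)}$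 is drawn from a trial density $r_{t-1}$ whose support covers that of $\pi_{t-1}$, and $w_{t-1}^{(j)}=\pi_{t-1}(\mathbf{x}_{t-1}^{(j)})/r_{t-1}(\mathbf{x}_{t-1}^{(j)})$. The subscript $\pi_{t+\Delta}$ on $\operatorname{var}$ and $E$ means that the operation is conditional on $\mathbf{y}_{t+\Delta}$ (so the observations are fixed and randomness comes from the Monte Carlo samples, or from the state under $\pi_{t+\Delta}$). In particular $$E_{\pi_{t+\Delta}}\big(h(\mathbf{x}_t)\mid\mathbf{x}_{t-1}=\mathbf{x}_{t-1}^{(j)}\big)=\int h(\mathbf{x}_{t-1}^{(j)},x_t)\,\pi_{t+\Delta}(x_t\mid\mathbf{x}_{t-1}^{(j)})\,dx_t .$$ "Square integrable" means $E_{\pi_{t+\Delta}}[h(\mathbf{x}_t)^2]<\infty$. As always in importance sampling, the support of $q_t(\cdot\mid\mathbf{x}_{t-1})$ covers that of $\pi_{t+\Delta}(\cdot\mid\mathbf{x}_{t-1})$. Ratios with zero numerator are read as $0$; variances may take the value $+\infty$. *)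

theory Defs
  imports "HOL-Probability.Probability"
begin

text \<open>
  Trajectories \<open>(x\<^sub>0,\<dots>,x\<^sub>s)\<close> are extensional functions on \<open>{0..s}\<close>, observation records
  \<open>(y\<^sub>1,\<dots>,y\<^sub>t)\<close> extensional functions on \<open>{1..t}\<close>.  For \<open>x\<close> a trajectory up to time \<open>t - 1\<close>,
  the extended trajectory \<open>(x, u)\<close> up to time \<open>t\<close> is \<open>x(t := u)\<close>.
  The reference measures (all written \<open>dx\<close> informally) are the products of \<open>\<mu> i\<close> and \<open>\<nu> i\<close>,
  and \<open>p n\<close> is a density of \<open>(X\<^sub>0,\<dots>,X\<^sub>n,Y\<^sub>1,\<dots>,Y\<^sub>n)\<close>.
\<close>

locale state_observation_model = prob_space M
  for M :: "'o measure" +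
  fixes \<mu> :: "nat \<Rightarrow> 'a measure"
    and \<nu> :: "nat \<Rightarrow> 'b measure"
    and X :: "nat \<Rightarrow> 'o \<Rightarrow> 'a"
    and Y :: "nat \<Rightarrow> 'o \<Rightarrow> 'b"
    and p :: "nat \<Rightarrow> (nat \<Rightarrow> 'a) \<times> (nat \<Rightarrow> 'b) \<Rightarrow> real"
  assumes sigma_finite_state: "sigma_finite_measure (\<mu> i)"
    and sigma_finite_obs: "sigma_finite_measure (\<nu> i)"
    and density_nonneg: "0 \<le> p n z"
    and joint_distributed:
      "distributed M (PiM {0..n} \<mu> \<Otimes>\<^sub>M PiM {1..n} \<nu>)
         (\<lambda>\<omega>. (\<lambda>i\<in>{0..n}. X i \<omega>, \<lambda>i\<in>{1..n}. Y i \<omega>)) (\<lambda>z. ennreal (p n z))"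

text \<open>
  The density \<open>p(x\<^sub>0,\<dots>,x\<^sub>s,y\<^sub>1,\<dots>,y\<^sub>t)\<close>, obtained from \<open>p (max s t)\<close> by integrating out
  the remaining coordinates.  Fixing these versions makes the conditional densities
  below well defined for each fixed observation record, not just up to null sets of records.
\<close>

definition joint_density ::
  "(nat \<Rightarrow> 'a measure) \<Rightarrow> (nat \<Rightarrow> 'b measure) \<Rightarrow> (nat \<Rightarrow> (nat \<Rightarrow> 'a) \<times> (nat \<Rightarrow> 'b) \<Rightarrow> real)
     \<Rightarrow> nat \<Rightarrow> nat \<Rightarrow> (nat \<Rightarrow> 'a) \<Rightarrow> (nat \<Rightarrow> 'b) \<Rightarrow> ennreal" where
  "joint_density \<mu> \<nu> p s t x y =
     (let n = max s t in
      \<integral>\<^sup>+ x'. (\<integral>\<^sup>+ y'.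
          ennreal (p n (merge {0..s} {s+1..n} (x, x'), merge {1..t} {t+1..n} (y, y')))
        \<partial>PiM {t+1..n} \<nu>) \<partial>PiM {s+1..n} \<mu>)"

definition obs_density ::
  "(nat \<Rightarrow> 'a measure) \<Rightarrow> (nat \<Rightarrow> 'b measure) \<Rightarrow> (nat \<Rightarrow> (nat \<Rightarrow> 'a) \<times> (nat \<Rightarrow> 'b) \<Rightarrow> real)
     \<Rightarrow> nat \<Rightarrow> (nat \<Rightarrow> 'b) \<Rightarrow> ennreal" where
  "obs_density \<mu> \<nu> p t y = (\<integral>\<^sup>+ x. joint_density \<mu> \<nu> p t t x y \<partial>PiM {0..t} \<mu>)"

text \<open>
  The records \<open>(y\<^sub>1,\<dots>,y\<^sub>t)\<close> one may condition on; almost every record under the law of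
  \<open>(Y\<^sub>1,\<dots>,Y\<^sub>t)\<close> is of this kind.
\<close>

definition admissible_obs ::
  "(nat \<Rightarrow> 'a measure) \<Rightarrow> (nat \<Rightarrow> 'b measure) \<Rightarrow> (nat \<Rightarrow> (nat \<Rightarrow> 'a) \<times> (nat \<Rightarrow> 'b) \<Rightarrow> real)
     \<Rightarrow> nat \<Rightarrow> (nat \<Rightarrow> 'b) \<Rightarrow> bool" where
  "admissible_obs \<mu> \<nu> p t y \<longleftrightarrow>
     (\<forall>i\<in>{1..t}. y i \<in> space (\<nu> i)) \<and>
     0 < obs_density \<mu> \<nu> p t y \<and> obs_density \<mu> \<nu> p t y < \<infinity>"

text \<open>
  \<open>post_density \<mu> \<nu> p y t s x\<close> is \<open>\<pi>\<^sub>t(x\<^sub>0,\<dots>,x\<^sub>s) = p(x\<^sub>0,\<dots>,x\<^sub>s | y\<^sub>1,\<dots>,y\<^sub>t)\<close>, and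
  \<open>post_step_density \<mu> \<nu> p y t s x u\<close> is the density \<open>\<pi>\<^sub>t(u | x) = p(u | x, y\<^sub>1,\<dots>,y\<^sub>t)\<close> of
  \<open>X\<^sub>s\<close> at \<open>u\<close> given the trajectory \<open>x\<close> up to time \<open>s - 1\<close> (for \<open>s \<ge> 1\<close>).
  An infinite value (possible on null sets only, for admissible records) is sent to \<open>0\<close>.
\<close>

definition post_density ::
  "(nat \<Rightarrow> 'a measure) \<Rightarrow> (nat \<Rightarrow> 'b measure) \<Rightarrow> (nat \<Rightarrow> (nat \<Rightarrow> 'a) \<times> (nat \<Rightarrow> 'b) \<Rightarrow> real)
     \<Rightarrow> (nat \<Rightarrow> 'b) \<Rightarrow> nat \<Rightarrow> nat \<Rightarrow> (nat \<Rightarrow> 'a) \<Rightarrow> real" where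
  "post_density \<mu> \<nu> p y t s x =
     enn2real (joint_density \<mu> \<nu> p s t x y / obs_density \<mu> \<nu> p t y)"

definition post_step_density ::
  "(nat \<Rightarrow> 'a measure) \<Rightarrow> (nat \<Rightarrow> 'b measure) \<Rightarrow> (nat \<Rightarrow> (nat \<Rightarrow> 'a) \<times> (nat \<Rightarrow> 'b) \<Rightarrow> real)
     \<Rightarrow> (nat \<Rightarrow> 'b) \<Rightarrow> nat \<Rightarrow> nat \<Rightarrow> (nat \<Rightarrow> 'a) \<Rightarrow> 'a \<Rightarrow> real" where
  "post_step_density \<mu> \<nu> p y t s x u =
     enn2real (joint_density \<mu> \<nu> p s t (x(s := u)) y / joint_density \<mu> \<nu> p (s - 1) t x y)"

text \<open>\<open>E\<^sub>\<pi>(h(x\<^sub>0,\<dots>,x\<^sub>s) | (x\<^sub>0,\<dots>,x\<^bsub>s-1\<^esub>) = x)\<close> for \<open>\<pi> = \<pi>\<^sub>t\<close>\<close>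

definition post_step_expectation ::
  "(nat \<Rightarrow> 'a measure) \<Rightarrow> (nat \<Rightarrow> 'b measure) \<Rightarrow> (nat \<Rightarrow> (nat \<Rightarrow> 'a) \<times> (nat \<Rightarrow> 'b) \<Rightarrow> real)
     \<Rightarrow> (nat \<Rightarrow> 'b) \<Rightarrow> nat \<Rightarrow> nat \<Rightarrow> ((nat \<Rightarrow> 'a) \<Rightarrow> real) \<Rightarrow> (nat \<Rightarrow> 'a) \<Rightarrow> real" where
  "post_step_expectation \<mu> \<nu> p y t s h x =
     (\<integral> u. h (x(s := u)) * post_step_density \<mu> \<nu> p y t s x u \<partial>\<mu> s)"

definition square_integrable_wrt :: "'s measure \<Rightarrow> ('s \<Rightarrow> real) \<Rightarrow> ('s \<Rightarrow> real) \<Rightarrow> bool" where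
  "square_integrable_wrt N f h \<longleftrightarrow>
     h \<in> borel_measurable N \<and> (\<integral>\<^sup>+ x. ennreal ((h x)\<^sup>2 * f x) \<partial>N) < \<infinity>"

text \<open>
  \<open>S\<close> is the probability space of the Monte Carlo randomness, \<open>f\<close> the target density and
  \<open>r\<close> the trial density.
\<close>

definition properly_weighted ::
  "'w measure \<Rightarrow> 's measure \<Rightarrow> ('s \<Rightarrow> real) \<Rightarrow> ('w \<Rightarrow> 's) \<Rightarrow> ('w \<Rightarrow> real) \<Rightarrow> bool" where
  "properly_weighted S N f \<xi> w \<longleftrightarrow>
     (\<exists>r. (\<forall>x\<in>space N. 0 \<le> r x) \<and>
          distributed S N \<xi> (\<lambda>x. ennreal (r x)) \<and>
          (\<forall>x\<in>space N. 0 < f x \<longrightarrow> 0 < r x) \<and>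
          (\<forall>\<omega>\<in>space S. w \<omega> = f (\<xi> \<omega>) / r (\<xi> \<omega>)))"

text \<open>
  Given \<open>\<xi>\<close>, the variable \<open>\<zeta>\<close> is drawn from the density \<open>q \<xi>\<close> with respect to \<open>L\<close>: the joint
  law of \<open>(\<xi>, \<zeta>)\<close> is (law of \<open>\<xi>\<close>)\<open>(dx) q(u | x) L(du)\<close>.
\<close>

definition drawn_given ::
  "'w measure \<Rightarrow> 's measure \<Rightarrow> 'a measure \<Rightarrow> ('s \<Rightarrow> 'a \<Rightarrow> real) \<Rightarrow> ('w \<Rightarrow> 's) \<Rightarrow> ('w \<Rightarrow> 'a) \<Rightarrow> bool" where
  "drawn_given S N L q \<xi> \<zeta> \<longleftrightarrow>
     (\<lambda>(x, u). q x u) \<in> borel_measurable (N \<Otimes>\<^sub>M L) \<and>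
     (\<forall>x\<in>space N. \<forall>u\<in>space L. 0 \<le> q x u) \<and>
     (\<forall>x\<in>space N. (\<integral>\<^sup>+ u. ennreal (q x u) \<partial>L) = 1) \<and>
     \<xi> \<in> measurable S N \<and> \<zeta> \<in> measurable S L \<and>
     distr S (N \<Otimes>\<^sub>M L) (\<lambda>\<omega>. (\<xi> \<omega>, \<zeta> \<omega>)) =
       density (distr S N \<xi> \<Otimes>\<^sub>M L) (\<lambda>(x, u). ennreal (q x u))"

text \<open>
  Variance with values in \<open>[0, \<infinity>]\<close>; the library's \<open>variance\<close> is \<open>0\<close> when the second moment is
  infinite.  If \<open>W\<close> is measurable but not integrable, its Bochner integral is \<open>0\<close> and the value
  below is the second moment, hence \<open>\<infinity>\<close>.
\<close>

definition ext_variance :: "'w measure \<Rightarrow> ('w \<Rightarrow> real) \<Rightarrow> ennreal" where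
  "ext_variance S W = (\<integral>\<^sup>+ \<omega>. ennreal ((W \<omega> - (\<integral> \<omega>'. W \<omega>' \<partial>S))\<^sup>2) \<partial>S)"

end

theory Submission
  imports Defs
begin

text \<open>
  Given \<open>\<xi> = x\<close>, each quantity weighted by \<open>w2\<close> has as conditional mean the quantity weighted by \<open>w1\<close>
  that it is compared with: the trial density cancels, and the support condition
  together with \<open>\<pi>(x, u) = \<pi>(x) \<pi>(u | x)\<close> turns the integral over \<open>u\<close> into the posterior one.  Conditioning
  keeps the mean and, by Cauchy-Schwarz on each fibre, cannot increase the second moment about it.
  Square integrability of \<open>h\<close> only serves to make the means finite.
\<close>

section \<open>Conditional sampling, variance and importance weights\<close>

text \<open>At \<open>b = 0\<close> and \<open>b = \<top>\<close> both sides are 0: the extended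
  quotient is then 0 or infinite, \<open>enn2real\<close> sends infinity to 0, and real division by
  0 gives 0. Posterior densities, which are such quotients, can therefore be cancelled as real
  fractions.\<close>

lemma enn2real_divide: "enn2real (a / b) = enn2real a / enn2real b"
proof (cases "b = 0 \<or> b = \<top>")
  case True
  then show ?thesis by (auto simp: ennreal_divide_zero divide_ennreal_def enn2real_mult)
next
  case False
  then obtain c where "b = ennreal c" "0 < c"
    by (cases b rule: ennreal_cases) (auto simp: less_le)
  then show ?thesis
    by (simp add: divide_ennreal_def enn2real_mult inverse_ennreal divide_inverse)
qed

text \<open>Tonelli for a conditionally drawn pair: the density form of the joint law in
  \<open>drawn_given\<close> is disintegrated over \<xi>. Absolute first moments and possibly
  infinite second moments are computed in this way.\<close>

lemma nn_integral_drawn_given: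
  assumes "sigma_finite_measure L" and drawn: "drawn_given S N L q \<xi> \<zeta>"
    and [measurable]: "\<phi> \<in> borel_measurable (N \<Otimes>\<^sub>M L)"
  shows "(\<integral>\<^sup>+\<omega>. \<phi> (\<xi> \<omega>, \<zeta> \<omega>) \<partial>S)
    = (\<integral>\<^sup>+x. (\<integral>\<^sup>+u. ennreal (q x u) * \<phi> (x, u) \<partial>L) \<partial>distr S N \<xi>)"
proof -
  interpret L: sigma_finite_measure L by fact
  have [measurable]: "\<xi> \<in> measurable S N" "\<zeta> \<in> measurable S L"
      "(\<lambda>(x, u). q x u) \<in> borel_measurable (N \<Otimes>\<^sub>M L)"
    and law: "distr S (N \<Otimes>\<^sub>M L) (\<lambda>\<omega>. (\<xi> \<omega>, \<zeta> \<omega>)) =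
       density (distr S N \<xi> \<Otimes>\<^sub>M L) (\<lambda>(x, u). ennreal (q x u))"
    using drawn unfolding drawn_given_def by blast+
  have "(\<integral>\<^sup>+\<omega>. \<phi> (\<xi> \<omega>, \<zeta> \<omega>) \<partial>S)
      = (\<integral>\<^sup>+z. \<phi> z \<partial>distr S (N \<Otimes>\<^sub>M L) (\<lambda>\<omega>. (\<xi> \<omega>, \<zeta> \<omega>)))"
    by (subst nn_integral_distr) auto
  also have "\<dots> = (\<integral>\<^sup>+z. (\<lambda>(x, u). ennreal (q x u)) z * \<phi> z \<partial>(distr S N \<xi> \<Otimes>\<^sub>M L))"
    unfolding law by (subst nn_integral_density) auto
  also have "\<dots> = (\<integral>\<^sup>+x. (\<integral>\<^sup>+u. ennreal (q x u) * \<phi> (x, u) \<partial>L) \<partial>distr S N \<xi>)"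
    by (subst L.nn_integral_fst[symmetric]) auto
  finally show ?thesis .
qed

text \<open>Jensen's inequality for the square, obtained from Cauchy-Schwarz against the constant 1
  under the probability with density \<rho>. The right side may be infinite; \<open>int\<close>
  makes the Bochner integral on the left a true mean.\<close>

lemma sq_integral_le_nn_integral_density:
  fixes f :: "'a \<Rightarrow> real"
  assumes [measurable]: "\<rho> \<in> borel_measurable L" and nonneg: "\<And>u. u \<in> space L \<Longrightarrow> 0 \<le> \<rho> u"
    and mass: "(\<integral>\<^sup>+u. ennreal (\<rho> u) \<partial>L) = 1"
    and f [measurable]: "f \<in> borel_measurable L"
    and int: "integrable L (\<lambda>u. \<rho> u * f u)"
  shows "ennreal (((\<integral>u. \<rho> u * f u \<partial>L) - c)\<^sup>2) \<le> (\<integral>\<^sup>+u. ennreal (\<rho> u) * ennreal ((f u - c)\<^sup>2) \<partial>L)"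
proof -
  define D where "D = density L (\<lambda>u. ennreal (\<rho> u))"
  have [measurable]: "f \<in> borel_measurable D" by (simp add: D_def)
  have one: "emeasure D (space D) = 1"
    using mass by (simp add: D_def emeasure_density cong: nn_integral_cong)
  interpret D: prob_space D by (rule prob_spaceI) (rule one)
  have "AE u in L. 0 \<le> \<rho> u" using nonneg by auto
  then have intD: "integrable D f" and eq: "(\<integral>u. f u \<partial>D) = (\<integral>u. \<rho> u * f u \<partial>L)"
    using int by (simp_all add: D_def integrable_density integral_density)
  \<comment> \<open>Total mass 1 lets \<open>c\<close> move under the integral. Absolute values then
    lead to \<open>ennreal\<close>, where Cauchy-Schwarz also covers an infinite second
    moment.\<close>
  have "(\<integral>u. f u \<partial>D) - c = (\<integral>u. f u - c \<partial>D)"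
    using intD by (simp add: D.prob_space)
  then have "ennreal \<bar>(\<integral>u. f u \<partial>D) - c\<bar> \<le> (\<integral>\<^sup>+u. ennreal \<bar>f u - c\<bar> \<partial>D)"
    using intD integral_norm_bound_ennreal[of D "\<lambda>u. f u - c"] by (simp add: D.prob_space)
  then have "(ennreal \<bar>(\<integral>u. f u \<partial>D) - c\<bar>)\<^sup>2 \<le> (\<integral>\<^sup>+u. ennreal \<bar>f u - c\<bar> * 1 \<partial>D)\<^sup>2"
    by (simp add: power_mono)
  also have "\<dots> \<le> (\<integral>\<^sup>+u. (ennreal \<bar>f u - c\<bar>)\<^sup>2 \<partial>D) * (\<integral>\<^sup>+u. 1\<^sup>2 \<partial>D)"
    by (rule Cauchy_Schwarz_nn_integral) auto
  finally have "ennreal (((\<integral>u. f u \<partial>D) - c)\<^sup>2) \<le> (\<integral>\<^sup>+u. ennreal ((f u - c)\<^sup>2) \<partial>D)"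
    using one by (simp add: ennreal_power)
  then show ?thesis
    unfolding eq by (simp add: D_def nn_integral_density)
qed

text \<open>The inequality half of the law of total variance. By \<open>mean\<close>, V is the
  conditional mean of W given \<xi>, so both variables have the same mean and their squared
  deviations from it are compared fibre by fibre. Second moments may be infinite.\<close>

lemma ext_variance_conditional_mean_le:
  assumes S: "prob_space S" and L: "sigma_finite_measure L"
    and drawn: "drawn_given S N L q \<xi> \<zeta>"
    and W [measurable]: "W \<in> borel_measurable (N \<Otimes>\<^sub>M L)" and V [measurable]: "V \<in> borel_measurable N"
    and int: "integrable S (\<lambda>\<omega>. W (\<xi> \<omega>, \<zeta> \<omega>))"
    and mean: "AE x in distr S N \<xi>. (\<integral>u. q x u * W (x, u) \<partial>L) = V x"
  shows "ext_variance S (\<lambda>\<omega>. V (\<xi> \<omega>)) \<le> ext_variance S (\<lambda>\<omega>. W (\<xi> \<omega>, \<zeta> \<omega>))"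
proof -
  interpret S: prob_space S by fact
  interpret L: sigma_finite_measure L by fact
  have [measurable]: "\<xi> \<in> measurable S N" "\<zeta> \<in> measurable S L"
      and q [measurable]: "(\<lambda>(x, u). q x u) \<in> borel_measurable (N \<Otimes>\<^sub>M L)"
      and q_nonneg: "\<And>x u. x \<in> space N \<Longrightarrow> u \<in> space L \<Longrightarrow> 0 \<le> q x u"
      and q_mass: "\<And>x. x \<in> space N \<Longrightarrow> (\<integral>\<^sup>+ u. ennreal (q x u) \<partial>L) = 1"
      and law: "distr S (N \<Otimes>\<^sub>M L) (\<lambda>\<omega>. (\<xi> \<omega>, \<zeta> \<omega>)) =
       density (distr S N \<xi> \<Otimes>\<^sub>M L) (\<lambda>(x, u). ennreal (q x u))"
    using drawn unfolding drawn_given_def by blast+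
  define P where "P = distr S N \<xi>"
  have sets_P [measurable_cong]: "sets P = sets N" and space_P: "space P = space N"
    by (simp_all add: P_def)
  interpret P: prob_space P unfolding P_def by (rule S.prob_space_distr) simp
  interpret PL: pair_sigma_finite P L ..
  have q_nonneg': "AE z in P \<Otimes>\<^sub>M L. 0 \<le> (\<lambda>(x, u). q x u) z"
    by (rule AE_I2) (auto simp: space_pair_measure space_P q_nonneg)
  have intW: "integrable (distr S (N \<Otimes>\<^sub>M L) (\<lambda>\<omega>. (\<xi> \<omega>, \<zeta> \<omega>))) W"
    using int by (subst integrable_distr_eq) auto
  have law': "distr S (N \<Otimes>\<^sub>M L) (\<lambda>\<omega>. (\<xi> \<omega>, \<zeta> \<omega>))
      = density (P \<Otimes>\<^sub>M L) (\<lambda>z. ennreal ((\<lambda>(x, u). q x u) z))"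
    unfolding law P_def by (simp add: case_prod_unfold)
  have int_qW: "integrable (P \<Otimes>\<^sub>M L) (\<lambda>z. (\<lambda>(x, u). q x u) z * W z)"
    using intW unfolding law' by (subst (asm) integrable_density) (use q_nonneg' in auto)
  \<comment> \<open>Fubini gives integrability on almost every fibre, so the fibrewise inequality
    below is an almost-everywhere one.\<close>
  have int_fst: "AE x in P. integrable L (\<lambda>u. q x u * W (x, u))"
    using PL.AE_integrable_fst'[OF int_qW] by simp
  \<comment> \<open>The mean of W, shown next to be the mean of V as well: a single centre for both
    variances permits the fibrewise comparison.\<close>
  define c where "c = (\<integral>\<omega>. W (\<xi> \<omega>, \<zeta> \<omega>) \<partial>S)"
  have "c = (\<integral>z. W z \<partial>distr S (N \<Otimes>\<^sub>M L) (\<lambda>\<omega>. (\<xi> \<omega>, \<zeta> \<omega>)))"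
    unfolding c_def by (subst integral_distr) auto
  also have "\<dots> = (\<integral>z. (\<lambda>(x, u). q x u) z * W z \<partial>(P \<Otimes>\<^sub>M L))"
    unfolding law' by (subst integral_density) (use q_nonneg' in auto)
  also have "\<dots> = (\<integral>x. (\<integral>u. q x u * W (x, u) \<partial>L) \<partial>P)"
    using PL.integral_fst'[OF int_qW] by simp
  also have "\<dots> = (\<integral>x. V x \<partial>P)"
    using mean unfolding P_def[symmetric] by (intro integral_cong_AE) auto
  also have "\<dots> = (\<integral>\<omega>. V (\<xi> \<omega>) \<partial>S)"
    unfolding P_def by (subst integral_distr) auto
  finally have c: "c = (\<integral>\<omega>. V (\<xi> \<omega>) \<partial>S)" .
  have "ext_variance S (\<lambda>\<omega>. V (\<xi> \<omega>)) = (\<integral>\<^sup>+x. ennreal ((V x - c)\<^sup>2) \<partial>P)"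
    unfolding ext_variance_def c[symmetric] P_def by (subst nn_integral_distr) auto
  also have "\<dots> \<le> (\<integral>\<^sup>+x. (\<integral>\<^sup>+u. ennreal (q x u) * ennreal ((W (x, u) - c)\<^sup>2) \<partial>L) \<partial>P)"
  proof (rule nn_integral_mono_AE)
    show "AE x in P. ennreal ((V x - c)\<^sup>2)
        \<le> (\<integral>\<^sup>+u. ennreal (q x u) * ennreal ((W (x, u) - c)\<^sup>2) \<partial>L)"
      using int_fst mean[folded P_def] AE_space
    proof eventually_elim
      case (elim x)
      then have x [measurable]: "x \<in> space N" by (simp add: space_P)
      have [measurable]: "q x \<in> borel_measurable L"
        using measurable_compose[OF measurable_Pair1'[OF x] q] by simp
      \<comment> \<open>Replacing \<open>V x\<close> by the fibre mean turns the claim into Jensen's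
        inequality for the density \<open>q x\<close>.\<close>
      show ?case
        unfolding elim(2)[symmetric]
        by (rule sq_integral_le_nn_integral_density) (use elim x in \<open>auto simp: q_nonneg q_mass\<close>)
    qed
  qed
  also have "\<dots> = ext_variance S (\<lambda>\<omega>. W (\<xi> \<omega>, \<zeta> \<omega>))"
    unfolding ext_variance_def c_def[symmetric] P_def
    by (subst nn_integral_drawn_given[OF L drawn, of "\<lambda>z. ennreal ((W z - c)\<^sup>2)"]) auto
  finally show ?thesis .
qed

text \<open>
  The constraint on \<open>a\<close> covers the normalised incoming weight \<open>1 / r\<close>, set to \<open>0\<close> where the
  past posterior or the trial density vanishes.
\<close>

lemma ext_variance_importance_weight_ge:
  fixes a F :: "'s \<Rightarrow> real" and G :: "'s \<times> 'a \<Rightarrow> real"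
  assumes S: "prob_space S" and L: "sigma_finite_measure L"
    and drawn: "drawn_given S N L q \<xi> \<zeta>"
    and \<xi>: "distributed S N \<xi> (\<lambda>x. ennreal (r x))"
    and a [measurable]: "a \<in> borel_measurable N"
    and a_nonneg: "\<And>x. x \<in> space N \<Longrightarrow> 0 \<le> a x" and ar: "\<And>x. x \<in> space N \<Longrightarrow> r x * a x \<le> 1"
    and F [measurable]: "F \<in> borel_measurable N"
    and G [measurable]: "G \<in> borel_measurable (N \<Otimes>\<^sub>M L)"
    and G_finite: "(\<integral>\<^sup>+x. (\<integral>\<^sup>+u. ennreal \<bar>G (x, u)\<bar> \<partial>L) \<partial>N) < \<infinity>"
    and marginal: "AE x in N. (\<integral>u. G (x, u) \<partial>L) = F x"
    and support: "AE x in N. AE u in L. G (x, u) \<noteq> 0 \<longrightarrow> 0 < q x u"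
  shows "ext_variance S (\<lambda>\<omega>. a (\<xi> \<omega>) * F (\<xi> \<omega>))
    \<le> ext_variance S (\<lambda>\<omega>. a (\<xi> \<omega>) * (G (\<xi> \<omega>, \<zeta> \<omega>) / q (\<xi> \<omega>) (\<zeta> \<omega>)))"
proof -
  interpret L: sigma_finite_measure L by fact
  have [measurable]: "\<xi> \<in> measurable S N" "\<zeta> \<in> measurable S L"
      and q [measurable]: "(\<lambda>(x, u). q x u) \<in> borel_measurable (N \<Otimes>\<^sub>M L)"
      and q_nonneg: "\<And>x u. x \<in> space N \<Longrightarrow> u \<in> space L \<Longrightarrow> 0 \<le> q x u"
    using drawn unfolding drawn_given_def by blast+
  have r [measurable]: "(\<lambda>x. ennreal (r x)) \<in> borel_measurable N"
    and P: "distr S N \<xi> = density N (\<lambda>x. ennreal (r x))"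
    using \<xi> by (auto simp: distributed_def)
  define W where "W = (\<lambda>z. a (fst z) * (G z / (\<lambda>(x, u). q x u) z))"
  have [measurable]: "W \<in> borel_measurable (N \<Otimes>\<^sub>M L)" unfolding W_def by measurable
  \<comment> \<open>In the sampling law \<xi> contributes \<open>r\<close> and \<zeta> contributes
    \<open>q\<close>; \<open>q\<close> cancels the denominator of \<open>W\<close>, and
    \<open>ar\<close> bounds the rest by |G|. As an inequality this holds at every point, also where
    \<open>q\<close> vanishes while G does not, since \<open>W\<close> is 0 there by division by
    0.\<close>
  have W_le: "ennreal (r x) * (\<integral>\<^sup>+u. ennreal (q x u) * ennreal \<bar>W (x, u)\<bar> \<partial>L)
      \<le> (\<integral>\<^sup>+u. ennreal \<bar>G (x, u)\<bar> \<partial>L)" if x: "x \<in> space N" for x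
  proof -
    have [measurable]: "q x \<in> borel_measurable L"
      using measurable_compose[OF measurable_Pair1'[OF x] q] by simp
    have [measurable]: "(\<lambda>u. W (x, u)) \<in> borel_measurable L"
      using x by measurable
    have "ennreal (r x) * (ennreal (q x u) * ennreal \<bar>W (x, u)\<bar>) \<le> ennreal \<bar>G (x, u)\<bar>"
      if u: "u \<in> space L" for u
    proof (cases "q x u = 0 \<or> r x \<le> 0")
      case True
      then show ?thesis by (auto simp: ennreal_neg)
    next
      case False
      then have "0 < q x u" "0 \<le> r x" using q_nonneg[OF x u] by auto
      then have "r x * (q x u * \<bar>W (x, u)\<bar>) = (r x * a x) * \<bar>G (x, u)\<bar>"
        using a_nonneg[OF x] by (simp add: W_def abs_mult)
      also have "\<dots> \<le> 1 * \<bar>G (x, u)\<bar>"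
        using ar[OF x] by (intro mult_right_mono) auto
      finally show ?thesis
        using \<open>0 < q x u\<close> \<open>0 \<le> r x\<close> by (simp flip: ennreal_mult add: ennreal_leI)
    qed
    then show ?thesis
      by (subst nn_integral_cmult[symmetric]) (auto intro!: nn_integral_mono)
  qed
  have "(\<integral>\<^sup>+\<omega>. ennreal (norm (W (\<xi> \<omega>, \<zeta> \<omega>))) \<partial>S)
      = (\<integral>\<^sup>+x. (\<integral>\<^sup>+u. ennreal (q x u) * ennreal \<bar>W (x, u)\<bar> \<partial>L) \<partial>distr S N \<xi>)"
    using nn_integral_drawn_given[OF L drawn, of "\<lambda>z. ennreal \<bar>W z\<bar>"] by simp
  also have "\<dots> = (\<integral>\<^sup>+x. ennreal (r x) * (\<integral>\<^sup>+u. ennreal (q x u) * ennreal \<bar>W (x, u)\<bar> \<partial>L) \<partial>N)"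
    unfolding P by (subst nn_integral_density) auto
  also have "\<dots> \<le> (\<integral>\<^sup>+x. (\<integral>\<^sup>+u. ennreal \<bar>G (x, u)\<bar> \<partial>L) \<partial>N)"
    by (rule nn_integral_mono) (rule W_le)
  finally have "integrable S (\<lambda>\<omega>. W (\<xi> \<omega>, \<zeta> \<omega>))"
    using G_finite by (intro integrableI_bounded) auto
  moreover have "AE x in distr S N \<xi>. (\<integral>u. q x u * W (x, u) \<partial>L) = a x * F x"
  proof -
    have "AE x in N. (\<integral>u. q x u * W (x, u) \<partial>L) = a x * F x"
      using marginal support AE_space
    proof eventually_elim
      case (elim x)
      note x = elim(3)
      have [measurable]: "q x \<in> borel_measurable L"
        using measurable_compose[OF measurable_Pair1'[OF x] q] by simp
      have [measurable]: "(\<lambda>u. W (x, u)) \<in> borel_measurable L"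
          "(\<lambda>u. G (x, u)) \<in> borel_measurable L"
        using x by measurable
      \<comment> \<open>Where \<open>q x u = 0\<close> the cancellation is correct only if
        \<open>a x * G (x, u)\<close> is 0, and \<open>support\<close> makes G vanish there for
        almost every u.\<close>
      have "(\<integral>u. q x u * W (x, u) \<partial>L) = (\<integral>u. a x * G (x, u) \<partial>L)"
        using elim(2) by (intro integral_cong_AE) (auto simp: W_def)
      then show ?case using elim(1) by simp
    qed
    then show ?thesis unfolding P by (subst AE_density) auto
  qed
  ultimately have "ext_variance S (\<lambda>\<omega>. a (\<xi> \<omega>) * F (\<xi> \<omega>)) \<le> ext_variance S (\<lambda>\<omega>. W (\<xi> \<omega>, \<zeta> \<omega>))"
    by (intro ext_variance_conditional_mean_le[OF S L drawn]) auto
  then show ?thesis by (simp add: W_def)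
qed

section \<open>Marginals of the joint density for a fixed observation record\<close>

context state_observation_model
begin

sublocale state: product_sigma_finite \<mu>
  by (rule product_sigma_finite.intro) (rule sigma_finite_state)

lemma measurable_density_section:
  assumes y: "\<forall>i\<in>{1..n}. y i \<in> space (\<nu> i)"
  shows "(\<lambda>x. ennreal (p n (x, restrict y {1..n}))) \<in> borel_measurable (PiM {0..n} \<mu>)"
proof -
  have p: "(\<lambda>z. ennreal (p n z)) \<in> borel_measurable (PiM {0..n} \<mu> \<Otimes>\<^sub>M PiM {1..n} \<nu>)"
    using joint_distributed[of n] by (auto simp: distributed_def)
  have "restrict y {1..n} \<in> space (PiM {1..n} \<nu>)"
    using y by (auto simp: space_PiM)
  then have "(\<lambda>x. (x, restrict y {1..n})) \<in> PiM {0..n} \<mu> \<rightarrow>\<^sub>M PiM {0..n} \<mu> \<Otimes>\<^sub>M PiM {1..n} \<nu>"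
    by simp
  from measurable_compose[OF this p] show ?thesis .
qed

lemma measurable_extend:
  assumes "1 \<le> s"
  shows "(\<lambda>(x, u). x(s := u)) \<in> PiM {0..s-1} \<mu> \<Otimes>\<^sub>M \<mu> s \<rightarrow>\<^sub>M PiM {0..s} \<mu>"
proof -
  have "insert s {0..s-1} = {0..s}" using assms by auto
  then show ?thesis using measurable_add_dim[of s "{0..s-1}" \<mu>] by simp
qed

text \<open>With the whole record up to n given, the integral over missing observations runs over
  the empty product, a one-point space of mass 1. Only the states after s remain to be
  integrated.\<close>

lemma joint_density_eq:
  assumes "s \<le> n"
  shows "joint_density \<mu> \<nu> p s n x y =
    (\<integral>\<^sup>+x'. ennreal (p n (merge {0..s} {s+1..n} (x, x'), restrict y {1..n})) \<partial>PiM {s+1..n} \<mu>)"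
proof -
  have "merge {1..n} {} (y, y') = restrict y {1..n}" for y'
    by (auto simp: merge_def restrict_def fun_eq_iff)
  then show ?thesis
    using assms by (simp add: joint_density_def max_absorb2 Let_def PiM_empty)
qed

lemma measurable_joint_density [measurable]:
  assumes "s \<le> n" and y: "\<forall>i\<in>{1..n}. y i \<in> space (\<nu> i)"
  shows "(\<lambda>x. joint_density \<mu> \<nu> p s n x y) \<in> borel_measurable (PiM {0..s} \<mu>)"
proof -
  interpret R: sigma_finite_measure "PiM {s+1..n} \<mu>" by (rule state.sigma_finite) simp
  have "{0..s} \<union> {s+1..n} = {0..n}" using assms by auto
  then have m: "merge {0..s} {s+1..n} \<in> PiM {0..s} \<mu> \<Otimes>\<^sub>M PiM {s+1..n} \<mu> \<rightarrow>\<^sub>M PiM {0..n} \<mu>"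
    using measurable_merge[of "{0..s}" "{s+1..n}" \<mu>] by simp
  show ?thesis
    unfolding joint_density_eq[OF assms(1)]
    by (rule R.borel_measurable_nn_integral)
      (use measurable_compose[OF m measurable_density_section[OF y]] in \<open>simp add: case_prod_unfold\<close>)
qed

text \<open>Tonelli splits coordinate s off the states s,...,n. Because both densities are iterated
  integrals of the same \<open>p n\<close>, the identity holds at every trajectory, not just almost
  everywhere.\<close>

lemma joint_density_marginal:
  assumes "1 \<le> s" "s \<le> n" and y: "\<forall>i\<in>{1..n}. y i \<in> space (\<nu> i)"
    and x: "x \<in> space (PiM {0..s-1} \<mu>)"
  shows "joint_density \<mu> \<nu> p (s-1) n x y = (\<integral>\<^sup>+u. joint_density \<mu> \<nu> p s n (x(s := u)) y \<partial>\<mu> s)"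
proof -
  have split: "{s-1+1..n} = insert s {s+1..n}" "{0..s-1} \<union> insert s {s+1..n} = {0..n}"
    using assms by auto
  have m: "(\<lambda>x'. merge {0..s-1} (insert s {s+1..n}) (x, x')) \<in> PiM (insert s {s+1..n}) \<mu> \<rightarrow>\<^sub>M PiM {0..n} \<mu>"
    using measurable_compose[OF measurable_Pair1'[OF x]
        measurable_merge[of "{0..s-1}" "insert s {s+1..n}" \<mu>]] split by simp
  have upd: "merge {0..s-1} (insert s {s+1..n}) (x, x'(s := u)) = merge {0..s} {s+1..n} (x(s := u), x')"
    for x' u using assms by (auto simp: merge_def fun_eq_iff)
  have "joint_density \<mu> \<nu> p (s-1) n x y =
      (\<integral>\<^sup>+x'. ennreal (p n (merge {0..s-1} (insert s {s+1..n}) (x, x'), restrict y {1..n}))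
        \<partial>PiM (insert s {s+1..n}) \<mu>)"
    using assms by (subst joint_density_eq, linarith) (simp only: split)
  also have "\<dots> = (\<integral>\<^sup>+u. (\<integral>\<^sup>+x'. ennreal (p n (merge {0..s-1} (insert s {s+1..n}) (x, x'(s := u)),
      restrict y {1..n})) \<partial>PiM {s+1..n} \<mu>) \<partial>\<mu> s)"
    by (rule state.product_nn_integral_insert_rev)
      (use measurable_compose[OF m measurable_density_section[OF y]] in auto)
  finally show ?thesis
    unfolding upd joint_density_eq[OF assms(2)] .
qed

text \<open>Integrating first the states after s and then those up to s is one integral over all
  states, by Tonelli. The normalising constant is thus the same for every s, and its finiteness for
  admissible records bounds the mass of each marginal.\<close>

lemma nn_integral_joint_density:
  assumes "s \<le> n" and y: "\<forall>i\<in>{1..n}. y i \<in> space (\<nu> i)"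
  shows "(\<integral>\<^sup>+x. joint_density \<mu> \<nu> p s n x y \<partial>PiM {0..s} \<mu>) = obs_density \<mu> \<nu> p n y"
proof -
  have split: "{0..n} = {0..s} \<union> {s+1..n}" using assms by auto
  have "merge {0..n} {} (x, x') = x" if "x \<in> space (PiM {0..n} \<mu>)" for x x'
    using that by (auto simp: merge_def space_PiM PiE_def extensional_def fun_eq_iff)
  then have "obs_density \<mu> \<nu> p n y = (\<integral>\<^sup>+x. ennreal (p n (x, restrict y {1..n})) \<partial>PiM {0..n} \<mu>)"
    unfolding obs_density_def
    by (intro nn_integral_cong) (simp add: joint_density_eq PiM_empty)
  also have "\<dots> = (\<integral>\<^sup>+x. (\<integral>\<^sup>+x'. ennreal (p n (merge {0..s} {s+1..n} (x, x'), restrict y {1..n}))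
      \<partial>PiM {s+1..n} \<mu>) \<partial>PiM {0..s} \<mu>)"
    unfolding split
    by (rule state.product_nn_integral_fold)
      (use measurable_density_section[OF y, unfolded split] in auto)
  finally show ?thesis using assms by (simp add: joint_density_eq)
qed

text \<open>Both identities come from the extended-valued joint densities and survive
  \<open>enn2real\<close> where these are finite. An infinite value would be sent to 0 and could
  break them, but it occurs on a null set only, since the total mass \<open>obs_density\<close> is
  finite.\<close>

lemma post_density_marginal:
  assumes y: "admissible_obs \<mu> \<nu> p n y" and s: "1 \<le> s" "s \<le> n"
  shows "AE x in PiM {0..s-1} \<mu>.
    (\<integral>\<^sup>+u. ennreal (post_density \<mu> \<nu> p y n s (x(s := u))) \<partial>\<mu> s) = ennreal (post_density \<mu> \<nu> p y n (s-1) x)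
    \<and> (AE u in \<mu> s. post_density \<mu> \<nu> p y n (s-1) x * post_step_density \<mu> \<nu> p y n s x u
         = post_density \<mu> \<nu> p y n s (x(s := u)))"
proof -
  define J where "J = (\<lambda>x u. joint_density \<mu> \<nu> p s n (x(s := u)) y)"
  define J' where "J' = (\<lambda>x. joint_density \<mu> \<nu> p (s-1) n x y)"
  define c where "c = obs_density \<mu> \<nu> p n y"
  have y_space: "\<forall>i\<in>{1..n}. y i \<in> space (\<nu> i)" and c: "0 < c" "c < \<infinity>"
    using y by (auto simp: admissible_obs_def c_def)
  have J_meas: "(\<lambda>(x, u). J x u) \<in> borel_measurable (PiM {0..s-1} \<mu> \<Otimes>\<^sub>M \<mu> s)"
    using measurable_compose[OF measurable_extend measurable_joint_density, OF s y_space]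
    by (simp add: J_def case_prod_unfold)
  have J'_meas [measurable]: "J' \<in> borel_measurable (PiM {0..s-1} \<mu>)"
    unfolding J'_def using s by (intro measurable_joint_density y_space) auto
  have "(\<integral>\<^sup>+x. J' x \<partial>PiM {0..s-1} \<mu>) = c"
    unfolding J'_def c_def using s by (intro nn_integral_joint_density y_space) auto
  then have "AE x in PiM {0..s-1} \<mu>. J' x \<noteq> \<infinity>"
    using c J'_meas by (intro nn_integral_noteq_infinite) (simp_all add: less_top)
  then show ?thesis
    using AE_space
  proof eventually_elim
    case (elim x)
    have [measurable]: "J x \<in> borel_measurable (\<mu> s)"
      using measurable_compose[OF measurable_Pair1'[OF elim(2)] J_meas] by simp
    have J': "J' x = (\<integral>\<^sup>+u. J x u \<partial>\<mu> s)"
      unfolding J_def J'_def by (rule joint_density_marginal[OF s y_space elim(2)])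
    then have finite: "AE u in \<mu> s. J x u \<noteq> \<infinity>"
      using elim(1) by (intro nn_integral_noteq_infinite) auto
    \<comment> \<open>On finite values \<open>ennreal\<close> inverts \<open>enn2real\<close>, so
      the normalised densities can be integrated as extended ones.\<close>
    have "(\<integral>\<^sup>+u. ennreal (enn2real (J x u / c)) \<partial>\<mu> s) = (\<integral>\<^sup>+u. J x u / c \<partial>\<mu> s)"
    proof (rule nn_integral_cong_AE)
      show "AE u in \<mu> s. ennreal (enn2real (J x u / c)) = J x u / c"
        using finite by eventually_elim (use c in \<open>auto simp: ennreal_enn2real_if ennreal_divide_eq_top_iff\<close>)
    qed
    also have "\<dots> = J' x / c"
      by (simp add: nn_integral_divide J')
    also have "\<dots> = ennreal (enn2real (J' x / c))"
      using elim(1) c by (auto simp: ennreal_enn2real_if ennreal_divide_eq_top_iff)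
    finally have "(\<integral>\<^sup>+u. ennreal (enn2real (J x u / c)) \<partial>\<mu> s) = ennreal (enn2real (J' x / c))" .
    \<comment> \<open>Where \<open>J' x = 0\<close> the left side is 0, and the right side agrees
      for almost every u because a nonnegative function with integral 0 vanishes almost everywhere.
      Otherwise the finite \<open>J' x\<close> cancels.\<close>
    moreover have "AE u in \<mu> s. enn2real (J' x / c) * enn2real (J x u / J' x) = enn2real (J x u / c)"
    proof (cases "J' x = 0")
      case True
      then have "AE u in \<mu> s. J x u = 0"
        unfolding J' by (subst (asm) nn_integral_0_iff_AE) auto
      then show ?thesis by (auto elim!: eventually_mono)
    next
      case False
      then have "enn2real (J' x) \<noteq> 0" using elim(1) by (auto simp: enn2real_eq_0_iff)
      then show ?thesis by (simp add: enn2real_divide)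
    qed
    ultimately show ?case
      by (simp add: post_density_def post_step_density_def J_def J'_def c_def)
  qed
qed

end

section \<open>Comparison of the lookahead weights\<close>

text \<open>Equality on \<open>space S\<close> is the form required, since
  \<open>properly_weighted\<close> determines the incoming weight there only.\<close>

lemma ext_variance_cong:
  assumes "\<And>\<omega>. \<omega> \<in> space S \<Longrightarrow> W \<omega> = W' \<omega>"
  shows "ext_variance S W = ext_variance S W'"
  using assms unfolding ext_variance_def
  by (metis (mono_tags, lifting) Bochner_Integration.integral_cong nn_integral_cong)

theorem proposition2:
  fixes M :: "'o measure"
    and \<mu> :: "nat \<Rightarrow> 'a measure"
    and \<nu> :: "nat \<Rightarrow> 'b measure"
    and X :: "nat \<Rightarrow> 'o \<Rightarrow> 'a"
    and Y :: "nat \<Rightarrow> 'o \<Rightarrow> 'b"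
    and p :: "nat \<Rightarrow> (nat \<Rightarrow> 'a) \<times> (nat \<Rightarrow> 'b) \<Rightarrow> real"
    and y :: "nat \<Rightarrow> 'b"
    and t \<Delta> :: nat
    and S :: "'w measure"
    and \<xi> :: "'w \<Rightarrow> nat \<Rightarrow> 'a"
    and \<zeta> :: "'w \<Rightarrow> 'a"
    and w w1 w2 :: "'w \<Rightarrow> real"
    and q :: "(nat \<Rightarrow> 'b) \<Rightarrow> (nat \<Rightarrow> 'a) \<Rightarrow> 'a \<Rightarrow> real"
  assumes model: "state_observation_model M \<mu> \<nu> X Y p"
    and t: "1 \<le> t"
    and obs_past: "admissible_obs \<mu> \<nu> p (t - 1) y"
    and obs_lookahead: "admissible_obs \<mu> \<nu> p (t + \<Delta>) y"
    and monte_carlo: "prob_space S"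
    and weighted_sample:
      "properly_weighted S (PiM {0..t - 1} \<mu>) (post_density \<mu> \<nu> p y (t - 1) (t - 1)) \<xi> w"
    and w1: "\<And>\<omega>. w1 \<omega> =
      w \<omega> * (post_density \<mu> \<nu> p y (t + \<Delta>) (t - 1) (\<xi> \<omega>)
              / post_density \<mu> \<nu> p y (t - 1) (t - 1) (\<xi> \<omega>))"
    and trial_no_future: "\<And>y1 y2. (\<forall>i\<in>{1..t}. y1 i = y2 i) \<Longrightarrow> q y1 = q y2"
    and trial_support: "\<And>x u. x \<in> space (PiM {0..t - 1} \<mu>) \<Longrightarrow> u \<in> space (\<mu> t) \<Longrightarrow>
      0 < post_step_density \<mu> \<nu> p y (t + \<Delta>) t x u \<Longrightarrow> 0 < q y x u"
    and trial_sample: "drawn_given S (PiM {0..t - 1} \<mu>) (\<mu> t) (q y) \<xi> \<zeta>"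
    and w2: "\<And>\<omega>. w2 \<omega> =
      w \<omega> * (post_density \<mu> \<nu> p y (t + \<Delta>) t ((\<xi> \<omega>)(t := \<zeta> \<omega>))
              / (post_density \<mu> \<nu> p y (t - 1) (t - 1) (\<xi> \<omega>) * q y (\<xi> \<omega>) (\<zeta> \<omega>)))"
  shows "ext_variance S w2 \<ge> ext_variance S w1 \<and>
    (\<forall>h. square_integrable_wrt (PiM {0..t} \<mu>) (post_density \<mu> \<nu> p y (t + \<Delta>) t) h \<longrightarrow>
       ext_variance S (\<lambda>\<omega>. w2 \<omega> * h ((\<xi> \<omega>)(t := \<zeta> \<omega>)))
         \<ge> ext_variance S (\<lambda>\<omega>. w1 \<omega> * post_step_expectation \<mu> \<nu> p y (t + \<Delta>) t h (\<xi> \<omega>)) \<and>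
       ext_variance S (\<lambda>\<omega>. w2 \<omega> * post_step_expectation \<mu> \<nu> p y (t + \<Delta>) t h (\<xi> \<omega>))
         \<ge> ext_variance S (\<lambda>\<omega>. w1 \<omega> * post_step_expectation \<mu> \<nu> p y (t + \<Delta>) t h (\<xi> \<omega>)))"
proof -
  interpret state_observation_model M \<mu> \<nu> X Y p by (rule model)
  define N where "N = PiM {0..t-1} \<mu>"
  define f0 where "f0 = post_density \<mu> \<nu> p y (t - 1) (t - 1)"
  define f1 where "f1 = post_density \<mu> \<nu> p y (t + \<Delta>) (t - 1)"
  define g where "g = (\<lambda>(x, u). post_density \<mu> \<nu> p y (t + \<Delta>) t (x(t := u)))"
  define k where "k = (\<lambda>(x, u). post_step_density \<mu> \<nu> p y (t + \<Delta>) t x u)"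
  have y0: "\<forall>i\<in>{1..t - 1}. y i \<in> space (\<nu> i)" and y1: "\<forall>i\<in>{1..t + \<Delta>}. y i \<in> space (\<nu> i)"
    using obs_past obs_lookahead by (auto simp: admissible_obs_def)
  have L: "sigma_finite_measure (\<mu> t)" by (rule sigma_finite_state)
  interpret L: sigma_finite_measure "\<mu> t" by (rule L)
  have drawn: "drawn_given S N (\<mu> t) (q y) \<xi> \<zeta>" using trial_sample by (simp add: N_def)
  have extend [measurable]: "(\<lambda>z. (fst z)(t := snd z)) \<in> N \<Otimes>\<^sub>M \<mu> t \<rightarrow>\<^sub>M PiM {0..t} \<mu>"
    using measurable_extend[OF t] by (simp add: N_def case_prod_unfold)
  have J_meas: "(\<lambda>x. joint_density \<mu> \<nu> p (t - 1) (t + \<Delta>) x y) \<in> borel_measurable N"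
      "(\<lambda>x. joint_density \<mu> \<nu> p (t - 1) (t - 1) x y) \<in> borel_measurable N"
      "(\<lambda>x. joint_density \<mu> \<nu> p t (t + \<Delta>) x y) \<in> borel_measurable (PiM {0..t} \<mu>)"
    unfolding N_def by (intro measurable_joint_density y0 y1; simp)+
  note [measurable] = J_meas(1,2) measurable_compose[OF extend J_meas(3)]
  have [measurable]: "f0 \<in> borel_measurable N" "f1 \<in> borel_measurable N"
      "g \<in> borel_measurable (N \<Otimes>\<^sub>M \<mu> t)" "k \<in> borel_measurable (N \<Otimes>\<^sub>M \<mu> t)"
    unfolding f0_def f1_def g_def k_def post_density_def post_step_density_def case_prod_unfold
    by measurable
  have g_nonneg: "0 \<le> g z" and k_nonneg: "0 \<le> k z" and f1_nonneg: "0 \<le> f1 x"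
      and f0_nonneg: "0 \<le> f0 x" for z x
    by (auto simp: g_def k_def f0_def f1_def post_density_def post_step_density_def split: prod.split)

  \<comment> \<open>Chain rule for the lookahead posterior and support of the trial density\<close>
  have "AE x in N. (\<integral>\<^sup>+u. ennreal (g (x, u)) \<partial>\<mu> t) = ennreal (f1 x)
      \<and> (AE u in \<mu> t. f1 x * k (x, u) = g (x, u))"
    using post_density_marginal[OF obs_lookahead t] by (simp only: N_def f1_def g_def k_def prod.case le_add1)
  then have g_marginal: "AE x in N. (\<integral>\<^sup>+u. ennreal (g (x, u)) \<partial>\<mu> t) = ennreal (f1 x)"
      and g_factor: "AE x in N. AE u in \<mu> t. f1 x * k (x, u) = g (x, u)"
    by auto
  have g_marginal': "AE x in N. (\<integral>u. g (x, u) \<partial>\<mu> t) = f1 x"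
    using g_marginal AE_space
  proof eventually_elim
    case (elim x)
    then show ?case
      by (subst integral_eq_nn_integral) (auto simp: g_nonneg f1_nonneg)
  qed
  \<comment> \<open>The trial density is assumed to cover the conditional density \<open>k\<close>.
    By the chain rule a nonzero \<open>g\<close> forces \<open>k\<close> to be nonzero, which
    carries the covering over to \<open>g\<close>.\<close>
  have support: "AE x in N. AE u in \<mu> t. g (x, u) \<noteq> 0 \<longrightarrow> 0 < q y x u"
    using g_factor AE_space
  proof eventually_elim
    case (elim x)
    show ?case
      using elim(1) AE_space
    proof eventually_elim
      case (elim u)
      have "0 < q y x u" if "g (x, u) \<noteq> 0"
      proof (rule trial_support)
        have "k (x, u) \<noteq> 0" using elim(1) that by auto
        then show "0 < post_step_density \<mu> \<nu> p y (t + \<Delta>) t x u"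
          using k_nonneg[of "(x, u)"] by (simp add: k_def)
      qed (use \<open>x \<in> space N\<close> elim(2) in \<open>simp_all add: N_def\<close>)
      then show ?case by simp
    qed
  qed

  \<comment> \<open>The normalised incoming weight\<close>
  obtain r where r_nonneg: "\<And>x. x \<in> space N \<Longrightarrow> 0 \<le> r x"
    and r: "distributed S N \<xi> (\<lambda>x. ennreal (r x))"
    and w: "\<And>\<omega>. \<omega> \<in> space S \<Longrightarrow> w \<omega> = f0 (\<xi> \<omega>) / r (\<xi> \<omega>)"
    using weighted_sample unfolding properly_weighted_def by (auto simp: N_def f0_def)
  have [measurable]: "(\<lambda>x. ennreal (r x)) \<in> borel_measurable N"
    using r by (simp add: distributed_def)
  \<comment> \<open>\<open>distributed\<close> gives measurability of \<open>ennreal (r x)\<close>;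
    as \<open>r\<close> is nonnegative on the space, \<open>enn2real\<close> recovers
    \<open>r\<close> itself.\<close>
  have "(\<lambda>x. enn2real (ennreal (r x))) \<in> borel_measurable N" by measurable
  then have [measurable]: "r \<in> borel_measurable N"
    by (rule measurable_cong[THEN iffD1, rotated]) (simp add: r_nonneg)
  \<comment> \<open>The incoming weight divided by the past posterior, so that the two new weights
    become \<open>a * f1\<close> and \<open>a * (g / q)\<close>. The factor \<open>f0\<close> is
    left uncancelled because \<open>a\<close> has to be 0 where \<open>f0\<close> vanishes;
    elsewhere it is \<open>1 / r\<close>.\<close>
  define a where "a = (\<lambda>x. f0 x / r x / f0 x)"
  have [measurable]: "a \<in> borel_measurable N" unfolding a_def by measurable
  have a_nonneg: "0 \<le> a x" and ar: "r x * a x \<le> 1" if "x \<in> space N" for x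
    using r_nonneg[OF that] f0_nonneg by (auto simp: a_def)

  \<comment> \<open>All three inequalities are instances: \<phi> is 1, then \<open>h\<close> at the
    extended trajectory, then the conditional expectation of \<open>h\<close> as a function of the
    past alone. Each time F is almost everywhere the integral of g \<phi> over the new
    state.\<close>
  have compare: "ext_variance S (\<lambda>\<omega>. a (\<xi> \<omega>) * F (\<xi> \<omega>))
      \<le> ext_variance S (\<lambda>\<omega>. a (\<xi> \<omega>) * (g (\<xi> \<omega>, \<zeta> \<omega>) * \<phi> (\<xi> \<omega>, \<zeta> \<omega>) / q y (\<xi> \<omega>) (\<zeta> \<omega>)))"
    if [measurable]: "F \<in> borel_measurable N" "\<phi> \<in> borel_measurable (N \<Otimes>\<^sub>M \<mu> t)"
      and fin: "(\<integral>\<^sup>+x. (\<integral>\<^sup>+u. ennreal \<bar>g (x, u) * \<phi> (x, u)\<bar> \<partial>\<mu> t) \<partial>N) < \<infinity>"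
      and eq: "AE x in N. (\<integral>u. g (x, u) * \<phi> (x, u) \<partial>\<mu> t) = F x" for F \<phi>
  proof -
    have "AE x in N. AE u in \<mu> t. g (x, u) * \<phi> (x, u) \<noteq> 0 \<longrightarrow> 0 < q y x u"
      using support by (auto elim!: eventually_mono)
    then show ?thesis
      using ext_variance_importance_weight_ge[OF monte_carlo L drawn r, where a = a and F = F
          and G = "\<lambda>z. g z * \<phi> z"] a_nonneg ar fin eq by simp
  qed
  have w1_eq: "w1 \<omega> = a (\<xi> \<omega>) * f1 (\<xi> \<omega>)"
    and w2_eq: "w2 \<omega> = a (\<xi> \<omega>) * (g (\<xi> \<omega>, \<zeta> \<omega>) / q y (\<xi> \<omega>) (\<zeta> \<omega>))" if "\<omega> \<in> space S" for \<omega>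
    using w[OF that] by (simp_all add: w1 w2 a_def f0_def f1_def g_def)

  \<comment> \<open>Finite mass and the comparison of the weights alone\<close>
  \<comment> \<open>Sending infinity to 0 can only decrease the mass, and the extended quotient
    integrates to a finite ratio of equal normalising constants.\<close>
  have "(\<integral>\<^sup>+x. ennreal (f1 x) \<partial>N) \<le> (\<integral>\<^sup>+x. joint_density \<mu> \<nu> p (t - 1) (t + \<Delta>) x y
      / obs_density \<mu> \<nu> p (t + \<Delta>) y \<partial>N)"
    by (intro nn_integral_mono) (auto simp: f1_def post_density_def ennreal_enn2real_if)
  also have "\<dots> = obs_density \<mu> \<nu> p (t + \<Delta>) y / obs_density \<mu> \<nu> p (t + \<Delta>) y"
    unfolding N_def using nn_integral_joint_density[of "t - 1" "t + \<Delta>" y] y1 J_meas(1)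
    by (subst nn_integral_divide) (auto simp: N_def)
  also have "\<dots> < \<infinity>"
    using obs_lookahead by (auto simp: admissible_obs_def ennreal_divide_eq_top_iff less_top)
  finally have "(\<integral>\<^sup>+x. ennreal (f1 x) \<partial>N) < \<infinity>" .
  moreover have "(\<integral>\<^sup>+x. (\<integral>\<^sup>+u. ennreal (g (x, u)) \<partial>\<mu> t) \<partial>N) = (\<integral>\<^sup>+x. ennreal (f1 x) \<partial>N)"
    using g_marginal by (rule nn_integral_cong_AE)
  ultimately have g_finite: "(\<integral>\<^sup>+x. (\<integral>\<^sup>+u. ennreal (g (x, u)) \<partial>\<mu> t) \<partial>N) < \<infinity>" by simp

  have "ext_variance S w1 = ext_variance S (\<lambda>\<omega>. a (\<xi> \<omega>) * f1 (\<xi> \<omega>))"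
    by (rule ext_variance_cong) (rule w1_eq)
  moreover have "ext_variance S w2
      = ext_variance S (\<lambda>\<omega>. a (\<xi> \<omega>) * (g (\<xi> \<omega>, \<zeta> \<omega>) / q y (\<xi> \<omega>) (\<zeta> \<omega>)))"
    by (rule ext_variance_cong) (rule w2_eq)
  ultimately have "ext_variance S w1 \<le> ext_variance S w2"
    using compare[of f1 "\<lambda>_. 1"] g_finite g_marginal'
    by (simp add: g_nonneg)

  \<comment> \<open>The two comparisons with a test function\<close>
  moreover have
    "ext_variance S (\<lambda>\<omega>. w1 \<omega> * post_step_expectation \<mu> \<nu> p y (t + \<Delta>) t h (\<xi> \<omega>))
        \<le> ext_variance S (\<lambda>\<omega>. w2 \<omega> * h ((\<xi> \<omega>)(t := \<zeta> \<omega>))) \<and>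
     ext_variance S (\<lambda>\<omega>. w1 \<omega> * post_step_expectation \<mu> \<nu> p y (t + \<Delta>) t h (\<xi> \<omega>))
        \<le> ext_variance S (\<lambda>\<omega>. w2 \<omega> * post_step_expectation \<mu> \<nu> p y (t + \<Delta>) t h (\<xi> \<omega>))"
    if sq: "square_integrable_wrt (PiM {0..t} \<mu>) (post_density \<mu> \<nu> p y (t + \<Delta>) t) h" for h
  proof -
    define \<eta> where "\<eta> = (\<lambda>z. h ((fst z)(t := snd z)))"
    define H where "H = post_step_expectation \<mu> \<nu> p y (t + \<Delta>) t h"
    have h [measurable]: "h \<in> borel_measurable (PiM {0..t} \<mu>)"
      using sq by (simp add: square_integrable_wrt_def)
    have \<eta> [measurable]: "\<eta> \<in> borel_measurable (N \<Otimes>\<^sub>M \<mu> t)" unfolding \<eta>_def by measurable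
    have H: "H x = (\<integral>u. \<eta> (x, u) * k (x, u) \<partial>\<mu> t)" for x
      by (simp add: H_def post_step_expectation_def \<eta>_def k_def)
    have [measurable]: "H \<in> borel_measurable N"
      unfolding H[abs_def] by measurable
    \<comment> \<open>Splitting off the last coordinate expresses square integrability by an
      iterated integral over the past and the new state.\<close>
    have "(\<integral>\<^sup>+x. ennreal ((h x)\<^sup>2 * post_density \<mu> \<nu> p y (t + \<Delta>) t x) \<partial>PiM {0..t} \<mu>)
        = (\<integral>\<^sup>+x. (\<integral>\<^sup>+u. ennreal ((\<eta> (x, u))\<^sup>2 * g (x, u)) \<partial>\<mu> t) \<partial>N)"
    proof -
      have split: "{0..t} = insert t {0..t-1}" using t by auto
      note [measurable] = J_meas(3)
      have "(\<lambda>x. ennreal ((h x)\<^sup>2 * post_density \<mu> \<nu> p y (t + \<Delta>) t x)) \<in> borel_measurable (PiM {0..t} \<mu>)"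
        unfolding post_density_def by measurable
      note state.product_nn_integral_insert[OF _ _ this[unfolded split]]
      then show ?thesis
        unfolding split N_def using t by (simp add: \<eta>_def g_def)
    qed
    then have sq_finite: "(\<integral>\<^sup>+x. (\<integral>\<^sup>+u. ennreal ((\<eta> (x, u))\<^sup>2 * g (x, u)) \<partial>\<mu> t) \<partial>N) < \<infinity>"
      using sq by (simp add: square_integrable_wrt_def)
    \<comment> \<open>This comes from (|\<eta>| - 1)^2 \<ge> 0. Since \<open>g\<close> has finite
      mass, square integrability against \<open>g\<close> thus implies integrability.\<close>
    have le: "\<bar>g z * \<eta> z\<bar> \<le> g z + (\<eta> z)\<^sup>2 * g z" for z
    proof -
      have "\<bar>\<eta> z\<bar> \<le> 1 + (\<eta> z)\<^sup>2"
        using zero_le_power2[of "\<bar>\<eta> z\<bar> - 1"] by (simp add: power2_diff)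
      then have "g z * \<bar>\<eta> z\<bar> \<le> g z * (1 + (\<eta> z)\<^sup>2)"
        by (rule mult_left_mono) (rule g_nonneg)
      then show ?thesis by (simp add: abs_mult g_nonneg algebra_simps)
    qed
    have "(\<integral>\<^sup>+x. (\<integral>\<^sup>+u. ennreal \<bar>g (x, u) * \<eta> (x, u)\<bar> \<partial>\<mu> t) \<partial>N)
        \<le> (\<integral>\<^sup>+x. (\<integral>\<^sup>+u. ennreal (g (x, u)) + ennreal ((\<eta> (x, u))\<^sup>2 * g (x, u)) \<partial>\<mu> t) \<partial>N)"
      using le g_nonneg
      by (intro nn_integral_mono) (simp flip: ennreal_plus add: ennreal_leI)
    also have "\<dots> = (\<integral>\<^sup>+x. (\<integral>\<^sup>+u. ennreal (g (x, u)) \<partial>\<mu> t)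
        + (\<integral>\<^sup>+u. ennreal ((\<eta> (x, u))\<^sup>2 * g (x, u)) \<partial>\<mu> t) \<partial>N)"
      by (intro nn_integral_cong nn_integral_add) measurable
    also have "\<dots> = (\<integral>\<^sup>+x. (\<integral>\<^sup>+u. ennreal (g (x, u)) \<partial>\<mu> t) \<partial>N)
        + (\<integral>\<^sup>+x. (\<integral>\<^sup>+u. ennreal ((\<eta> (x, u))\<^sup>2 * g (x, u)) \<partial>\<mu> t) \<partial>N)"
      by (intro nn_integral_add) measurable
    also have "\<dots> < \<infinity>" using g_finite sq_finite by simp
    finally have g\<eta>_finite: "(\<integral>\<^sup>+x. (\<integral>\<^sup>+u. ennreal \<bar>g (x, u) * \<eta> (x, u)\<bar> \<partial>\<mu> t) \<partial>N) < \<infinity>" .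

    \<comment> \<open>The chain rule pulls \<open>f1 x\<close> out of the fibre integral and leaves
      the conditional expectation \<open>H x\<close>. Pulling out a constant is valid for the
      Bochner integral also when it takes its default value 0 on a nonintegrable function.\<close>
    have g\<eta>_mean: "AE x in N. (\<integral>u. g (x, u) * \<eta> (x, u) \<partial>\<mu> t) = f1 x * H x"
      using g_factor AE_space
    proof eventually_elim
      case (elim x)
      note [measurable] = elim(2)
      have "(\<integral>u. g (x, u) * \<eta> (x, u) \<partial>\<mu> t) = (\<integral>u. f1 x * (\<eta> (x, u) * k (x, u)) \<partial>\<mu> t)"
      proof (rule integral_cong_AE)
        show "AE u in \<mu> t. g (x, u) * \<eta> (x, u) = f1 x * (\<eta> (x, u) * k (x, u))"
          using elim(1)
        proof eventually_elim
          case (elim u)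
          show ?case unfolding elim[symmetric] by simp
        qed
      qed measurable
      then show ?case by (simp add: H)
    qed
    \<comment> \<open>As \<open>H\<close> depends on the past only, integrating out the new state
      acts on \<open>g\<close> alone. The result is the same as for \<eta>, so both comparisons have
      the same smaller variance.\<close>
    have gH_mean: "AE x in N. (\<integral>u. g (x, u) * H x \<partial>\<mu> t) = f1 x * H x"
      using g_marginal' by eventually_elim simp
    \<comment> \<open>Conditional expectation contracts the first moment: |f1 H| is the modulus of
      the fibre integral of g \<eta>, hence at most the fibre integral of |g \<eta>|.\<close>
    have "(\<integral>\<^sup>+x. (\<integral>\<^sup>+u. ennreal \<bar>g (x, u) * H x\<bar> \<partial>\<mu> t) \<partial>N)
        \<le> (\<integral>\<^sup>+x. (\<integral>\<^sup>+u. ennreal \<bar>g (x, u) * \<eta> (x, u)\<bar> \<partial>\<mu> t) \<partial>N)"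
    proof (rule nn_integral_mono_AE)
      show "AE x in N. (\<integral>\<^sup>+u. ennreal \<bar>g (x, u) * H x\<bar> \<partial>\<mu> t)
          \<le> (\<integral>\<^sup>+u. ennreal \<bar>g (x, u) * \<eta> (x, u)\<bar> \<partial>\<mu> t)"
        using g_marginal g\<eta>_mean AE_space
      proof eventually_elim
        case (elim x)
        note [measurable] = elim(3)
        have "(\<integral>\<^sup>+u. ennreal \<bar>g (x, u) * H x\<bar> \<partial>\<mu> t) = (\<integral>\<^sup>+u. ennreal (g (x, u)) * ennreal \<bar>H x\<bar> \<partial>\<mu> t)"
          by (simp add: abs_mult g_nonneg ennreal_mult)
        also have "\<dots> = ennreal (f1 x) * ennreal \<bar>H x\<bar>"
          unfolding elim(1)[symmetric] by (rule nn_integral_multc) measurable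
        also have "\<dots> = ennreal (norm (\<integral>u. g (x, u) * \<eta> (x, u) \<partial>\<mu> t))"
          by (simp add: elim(2) abs_mult f1_nonneg ennreal_mult)
        \<comment> \<open>Without integrability the Bochner integral is 0 and the bound is
          trivial.\<close>
        also have "\<dots> \<le> (\<integral>\<^sup>+u. ennreal (norm (g (x, u) * \<eta> (x, u))) \<partial>\<mu> t)"
          by (cases "integrable (\<mu> t) (\<lambda>u. g (x, u) * \<eta> (x, u))")
            (simp_all add: integral_norm_bound_ennreal not_integrable_integral_eq del: real_norm_def)
        finally show ?case by simp
      qed
    qed
    then have gH_finite: "(\<integral>\<^sup>+x. (\<integral>\<^sup>+u. ennreal \<bar>g (x, u) * H x\<bar> \<partial>\<mu> t) \<partial>N) < \<infinity>"
      using g\<eta>_finite by (rule le_less_trans)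

    have w1H: "ext_variance S (\<lambda>\<omega>. w1 \<omega> * H (\<xi> \<omega>))
        = ext_variance S (\<lambda>\<omega>. a (\<xi> \<omega>) * (f1 (\<xi> \<omega>) * H (\<xi> \<omega>)))"
      by (rule ext_variance_cong) (simp add: w1_eq)
    have "ext_variance S (\<lambda>\<omega>. w2 \<omega> * h ((\<xi> \<omega>)(t := \<zeta> \<omega>))) = ext_variance S (\<lambda>\<omega>. a (\<xi> \<omega>)
        * (g (\<xi> \<omega>, \<zeta> \<omega>) * \<eta> (\<xi> \<omega>, \<zeta> \<omega>) / q y (\<xi> \<omega>) (\<zeta> \<omega>)))"
      by (rule ext_variance_cong) (simp add: w2_eq \<eta>_def)
    \<comment> \<open>Writing \<open>H (fst (\<xi> \<omega>, \<zeta> \<omega>))\<close> gives this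
      factor the shape of a function of the pair, as \<open>compare\<close> expects.\<close>
    moreover have "ext_variance S (\<lambda>\<omega>. w2 \<omega> * H (\<xi> \<omega>)) = ext_variance S (\<lambda>\<omega>. a (\<xi> \<omega>)
        * (g (\<xi> \<omega>, \<zeta> \<omega>) * H (fst (\<xi> \<omega>, \<zeta> \<omega>)) / q y (\<xi> \<omega>) (\<zeta> \<omega>)))"
      by (rule ext_variance_cong) (simp add: w2_eq)
    ultimately show ?thesis
      using compare[of "\<lambda>x. f1 x * H x" \<eta>] g\<eta>_finite g\<eta>_mean
        compare[of "\<lambda>x. f1 x * H x" "\<lambda>z. H (fst z)"] gH_finite gH_mean
      unfolding H_def[symmetric] w1H by simp
  qed
  ultimately show ?thesis by blast
qed

end
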